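(* Let $n\ge3$ and $D_n=\langle a,b\mid a^n=b^2=1,\ ab=ba^{-1}\rangle$, and let $\tau(n)$ be the number of positive divisors of $n$. Then $\Gamma(D_n)\cong K_r+\Gamma_N(D_n)$, where $r=\tau(n)+1$ if $n$ is even and $r=\tau(n)-1$ if $n$ is odd.
   Context: For a group $G$, $\Gamma(G)$ is the simple graph whose vertices are the subgroups of $G$ other than $\{1\}$ and $G$, and $\Gamma_N(G)$ is the simple graph whose vertices are the proper non-normal subgroups of $G$; in both, two distinct vertices $H,K$ are adjacent iff $HK=KH$. $K_r$ is the complete graph on $r$ vertices and $G_1+G_2$ is the join (disjoint union plus all edges between $G_1$ and $G_2$). *)

theory Defs
  imports
    "HOL-Algebra.Coset"
    "Graph_Theory.Pair_Digraph"
    "Graph_Theory.Digraph_Isomorphism"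
    "Graph_Theory.Kuratowski"
begin

text \<open>A word over the generators \<open>'g\<close> and their formal inverses: \<open>(x, True)\<close> stands
  for \<open>x\<close> and \<open>(x, False)\<close> for its inverse.\<close>

type_synonym 'g word = "('g \<times> bool) list"

text \<open>A pair \<open>(u, v) \<in> R\<close> is the relation \<open>u = v\<close>. Since the inverse letters cancel, the
  quotient of the free monoid of words by the congruence below is the quotient of the
  free group by the normal closure of all \<open>u v\<^sup>-\<^sup>1\<close>.\<close>

inductive word_eq :: "('g word \<times> 'g word) set \<Rightarrow> 'g word \<Rightarrow> 'g word \<Rightarrow> bool"
  for R :: "('g word \<times> 'g word) set" where
  word_eq_rel: "(u, v) \<in> R \<Longrightarrow> word_eq R u v"
| word_eq_cancel: "word_eq R [(x, e), (x, \<not> e)] []"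
| word_eq_append: "word_eq R u u' \<Longrightarrow> word_eq R v v' \<Longrightarrow> word_eq R (u @ v) (u' @ v')"
| word_eq_refl: "word_eq R u u"
| word_eq_sym: "word_eq R u v \<Longrightarrow> word_eq R v u"
| word_eq_trans: "word_eq R u v \<Longrightarrow> word_eq R v w \<Longrightarrow> word_eq R u w"

definition word_class :: "('g word \<times> 'g word) set \<Rightarrow> 'g word \<Rightarrow> 'g word set" where
  "word_class R u = {v. word_eq R u v}"

definition presented_group :: "('g word \<times> 'g word) set \<Rightarrow> 'g word set monoid" where
  "presented_group R =
    \<lparr>carrier = range (word_class R),
     monoid.mult = (\<lambda>X Y. {w. \<exists>u\<in>X. \<exists>v\<in>Y. word_eq R (u @ v) w}),
     monoid.one = word_class R []\<rparr>"

lemma word_class_eq_iff: "word_class R u = word_class R v \<longleftrightarrow> word_eq R u v"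
  unfolding word_class_def by (blast intro: word_eq_refl word_eq_sym word_eq_trans)

lemma presented_group_mult:
  "word_class R u \<otimes>\<^bsub>presented_group R\<^esub> word_class R v = word_class R (u @ v)"
  unfolding word_class_def presented_group_def
  by simp (blast intro: word_eq_refl word_eq_sym word_eq_trans word_eq_append)

lemma word_eq_inverse: "word_eq R (map (\<lambda>(x, e). (x, \<not> e)) (rev u) @ u) []"
proof (induction u)
  case Nil
  show ?case by (simp add: word_eq_refl)
next
  case (Cons p u)
  obtain x e where p: "p = (x, e)" by force
  let ?i = "map (\<lambda>(x, e). (x, \<not> e)) (rev u)"
  have "word_eq R ([(x, \<not> e), (x, e)] @ u) ([] @ u)"
    using word_eq_cancel[of R x "\<not> e"] by (intro word_eq_append word_eq_refl) simp
  then have "word_eq R (?i @ ([(x, \<not> e), (x, e)] @ u)) (?i @ u)"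
    by (intro word_eq_append word_eq_refl) simp
  with Cons.IH show ?case using p by (auto intro: word_eq_trans)
qed

lemma presented_group_carrier: "carrier (presented_group R) = range (word_class R)"
  and presented_group_one: "\<one>\<^bsub>presented_group R\<^esub> = word_class R []"
  by (simp_all add: presented_group_def)

lemma group_presented_group: "group (presented_group R)"
proof (rule groupI)
  fix X assume "X \<in> carrier (presented_group R)"
  then obtain u where "X = word_class R u" by (auto simp: presented_group_carrier)
  then have "word_class R (map (\<lambda>(x, e). (x, \<not> e)) (rev u)) \<otimes>\<^bsub>presented_group R\<^esub> X
      = \<one>\<^bsub>presented_group R\<^esub>"
    using word_eq_inverse[of R u]
    by (simp add: presented_group_mult presented_group_one word_class_eq_iff)
  then show "\<exists>Y\<in>carrier (presented_group R). Y \<otimes>\<^bsub>presented_group R\<^esub> X = \<one>\<^bsub>presented_group R\<^esub>"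
    by (auto simp: presented_group_carrier)
qed (auto simp: presented_group_carrier presented_group_one presented_group_mult)

definition word_value :: "('h, 'm) monoid_scheme \<Rightarrow> ('g \<Rightarrow> 'h) \<Rightarrow> 'g word \<Rightarrow> 'h" where
  "word_value H f u = foldr (\<lambda>(x, e) y. (if e then f x else inv\<^bsub>H\<^esub> f x) \<otimes>\<^bsub>H\<^esub> y) u \<one>\<^bsub>H\<^esub>"

lemma presented_group_universal:
  assumes "group H" and f: "\<And>x. f x \<in> carrier H"
    and R: "\<And>u v. (u, v) \<in> R \<Longrightarrow> word_value H f u = word_value H f v"
  shows "\<exists>h\<in>hom (presented_group R) H. \<forall>x. h (word_class R [(x, True)]) = f x"
proof -
  interpret H: group H by fact
  have nil: "word_value H f [] = \<one>\<^bsub>H\<^esub>" by (simp add: word_value_def)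
  have cons: "word_value H f ((x, e) # u)
      = (if e then f x else inv\<^bsub>H\<^esub> f x) \<otimes>\<^bsub>H\<^esub> word_value H f u" for x e u
    by (simp add: word_value_def)
  have closed: "word_value H f u \<in> carrier H" for u
    by (induction u) (auto simp: nil cons f)
  have app: "word_value H f (u @ v) = word_value H f u \<otimes>\<^bsub>H\<^esub> word_value H f v" for u v
    by (induction u) (auto simp: nil cons f closed H.m_assoc)
  have inv: "word_value H f u = word_value H f v" if "word_eq R u v" for u v
    using that by induction (auto simp: R nil cons app f)
  define h where "h X = word_value H f (SOME u. u \<in> X)" for X
  have h: "h (word_class R u) = word_value H f u" for u
  proof -
    have "(SOME v. v \<in> word_class R u) \<in> word_class R u"
      by (rule someI[of _ u]) (simp add: word_class_def word_eq_refl)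
    then show ?thesis
      using inv unfolding h_def word_class_def by (metis mem_Collect_eq)
  qed
  have "h \<in> hom (presented_group R) H"
  proof (rule homI)
    fix X Y assume "X \<in> carrier (presented_group R)" "Y \<in> carrier (presented_group R)"
    then obtain u v where "X = word_class R u" "Y = word_class R v"
      by (auto simp: presented_group_def)
    then show "h (X \<otimes>\<^bsub>presented_group R\<^esub> Y) = h X \<otimes>\<^bsub>H\<^esub> h Y"
      by (simp add: presented_group_mult h app)
  qed (auto simp: presented_group_def h closed)
  then show ?thesis by (rule bexI[rotated]) (simp add: h nil cons f)
qed

datatype dihedral_gen = Gen_a | Gen_b

definition dihedral_group :: "nat \<Rightarrow> dihedral_gen word set monoid" where
  "dihedral_group n = presented_group
    {(replicate n (Gen_a, True), []),
     ([(Gen_b, True), (Gen_b, True)], []),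
     ([(Gen_a, True), (Gen_b, True)], [(Gen_b, True), (Gen_a, False)])}"

text \<open>Simple graphs are represented by symmetric loop-free digraphs without parallel arcs.\<close>

definition permutability_graph_on ::
    "('a, 'm) monoid_scheme \<Rightarrow> 'a set set \<Rightarrow> 'a set pair_pre_digraph" where
  "permutability_graph_on G S =
    \<lparr>pverts = S,
     parcs = {(H, K). H \<in> S \<and> K \<in> S \<and> H \<noteq> K \<and> H <#>\<^bsub>G\<^esub> K = K <#>\<^bsub>G\<^esub> H}\<rparr>"

definition permutability_graph :: "('a, 'm) monoid_scheme \<Rightarrow> 'a set pair_pre_digraph" where
  "permutability_graph G = permutability_graph_on G
    {H. subgroup H G \<and> H \<noteq> {\<one>\<^bsub>G\<^esub>} \<and> H \<noteq> carrier G}"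

definition nonnormal_permutability_graph ::
    "('a, 'm) monoid_scheme \<Rightarrow> 'a set pair_pre_digraph" where
  "nonnormal_permutability_graph G = permutability_graph_on G
    {H. subgroup H G \<and> H \<noteq> carrier G \<and> \<not> H \<lhd> G}"

lemma pair_bidirected_permutability_graph_on:
  "pair_bidirected_digraph (permutability_graph_on G S)"
  by unfold_locales
    (auto simp: permutability_graph_on_def symmetric_def intro!: symI)

definition complete_graph :: "nat \<Rightarrow> nat pair_pre_digraph" where
  "complete_graph r =
    \<lparr>pverts = {..<r}, parcs = {(i, j). i < r \<and> j < r \<and> i \<noteq> j}\<rparr>"

lemma complete_graph_complete_digraph: "K\<^bsub>r\<^esub> (with_proj (complete_graph r))"
  by (simp add: complete_digraph_pair_def complete_graph_def)

definition graph_join ::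
    "'a pair_pre_digraph \<Rightarrow> 'b pair_pre_digraph \<Rightarrow> ('a + 'b) pair_pre_digraph" where
  "graph_join G H =
    \<lparr>pverts = pverts G <+> pverts H,
     parcs = {(Inl u, Inl v) | u v. (u, v) \<in> parcs G}
       \<union> {(Inr u, Inr v) | u v. (u, v) \<in> parcs H}
       \<union> {(Inl u, Inr v) | u v. u \<in> pverts G \<and> v \<in> pverts H}
       \<union> {(Inr v, Inl u) | u v. u \<in> pverts G \<and> v \<in> pverts H}\<rparr>"

definition num_divisors :: "nat \<Rightarrow> nat" where
  "num_divisors n = card {d. d dvd n}"

end

theory Submission
  imports Defs "HOL-Algebra.Generated_Groups"
begin

text \<open>A normal subgroup permutes with every subgroup, so in any group the non-trivial proper
  normal subgroups form a complete graph joined to the graph of non-normal subgroups, and only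
  their number has to be found. In $D_n$ a subgroup of rotations corresponds to a divisor of $n$
  and is normal. Conjugating a reflection by the rotation $a$ multiplies it by $a^2$, so a proper
  normal subgroup with a reflection has exactly the even powers of $a$ as rotations; such
  subgroups exist only if $n$ is even, and then there are two. That the powers $a^i$, $a^i b$ are as distinct
  as they should be is read off the homomorphism from the presented group to an explicit model.\<close>

section \<open>Splitting off the normal subgroups in an arbitrary group\<close>

definition proper_normal_subgroups :: "('a, 'm) monoid_scheme \<Rightarrow> 'a set set" where
  "proper_normal_subgroups G = {H. H \<lhd> G \<and> H \<noteq> {\<one>\<^bsub>G\<^esub>} \<and> H \<noteq> carrier G}"

text \<open>Any numbering of the finitely many normal vertices gives the isomorphism: distinct
  vertices, at least one of them normal, are adjacent on both sides, and the non-normal vertices are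
  kept as they are.\<close>

lemma (in group) permutability_graph_iso_join:
  assumes "finite (proper_normal_subgroups G)"
  shows "digraph_iso (with_proj (permutability_graph G))
    (with_proj (graph_join (complete_graph (card (proper_normal_subgroups G)))
      (nonnormal_permutability_graph G)))"
proof -
  define N where "N = proper_normal_subgroups G"
  define S where "S = {H. subgroup H G \<and> H \<noteq> carrier G \<and> \<not> H \<lhd> G}"
  have fin: "finite N" unfolding N_def by (rule assms)
  obtain f where f: "bij_betw f N {..<card N}"
    using ex_bij_betw_finite_nat[OF fin] by (auto simp: lessThan_atLeast0)
  \<comment> \<open>The trivial subgroup is normal, so it is absent from \<open>S\<close> although
    \<open>S\<close> does not exclude it explicitly.\<close>
  have V: "{H. subgroup H G \<and> H \<noteq> {\<one>} \<and> H \<noteq> carrier G} = N \<union> S"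
    using one_is_normal
    by (auto simp: N_def S_def proper_normal_subgroups_def normal_imp_subgroup)
  have disj: "N \<inter> S = {}" by (auto simp: N_def S_def proper_normal_subgroups_def)
  have comm: "H <#> K = K <#> H" if "H \<in> N \<and> K \<in> N \<union> S \<or> H \<in> N \<union> S \<and> K \<in> N" for H K
    using that commut_normal[of K H] commut_normal[of H K]
    by (auto simp: N_def S_def proper_normal_subgroups_def normal_imp_subgroup)
  define g where "g H = (if H \<in> N then Inl (f H) else Inr H)" for H
  have gN: "g H = Inl (f H)" if "H \<in> N" for H using that by (simp add: g_def)
  have gS: "g H = Inr H" if "H \<in> S" for H
    using that disj by (auto simp: g_def)
  have f_inj: "f H = f K \<longleftrightarrow> H = K" if "H \<in> N" "K \<in> N" for H K
    using f that by (auto simp: bij_betw_def inj_on_def)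
  have f_less: "f H < card N" if "H \<in> N" for H
    using f that by (auto simp: bij_betw_def)
  have g_inj: "inj_on g (N \<union> S)"
    unfolding inj_on_def by (auto simp: gN gS f_inj)
  let ?G = "permutability_graph_on G (N \<union> S)"
  let ?J = "graph_join (complete_graph (card N)) (permutability_graph_on G S)"
  have img_verts: "g ` (N \<union> S) = pverts ?J"
  proof -
    have "g ` N = Inl ` {..<card N}"
      using f by (auto simp: gN image_image bij_betw_def cong: image_cong)
    moreover have "g ` S = Inr ` S" by (auto simp: gS cong: image_cong)
    ultimately show ?thesis
      unfolding image_Un
      by (simp add: graph_join_def complete_graph_def permutability_graph_on_def Plus_def)
  qed
  have arc_iff: "(g H, g K) \<in> parcs ?J \<longleftrightarrow> (H, K) \<in> parcs ?G"
    if HK: "H \<in> N \<union> S" "K \<in> N \<union> S" for H K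
  proof -
    have P: "(H, K) \<in> parcs ?G \<longleftrightarrow> H \<noteq> K \<and> H <#> K = K <#> H"
      using HK by (simp add: permutability_graph_on_def)
    consider "H \<in> N" "K \<in> N" | "H \<in> N" "K \<in> S" | "H \<in> S" "K \<in> N" | "H \<in> S" "K \<in> S"
      using HK by blast
    then show ?thesis
    proof cases
      case 1
      then show ?thesis unfolding P using comm[of H K]
        by (simp add: gN graph_join_def complete_graph_def f_inj f_less)
    next
      case 2
      then have "H \<noteq> K" using disj by blast
      with 2 show ?thesis unfolding P using comm[of H K]
        by (simp add: gN gS graph_join_def complete_graph_def permutability_graph_on_def f_less)
    next
      case 3
      then have "H \<noteq> K" using disj by blast
      with 3 show ?thesis unfolding P using comm[of H K]
        by (simp add: gN gS graph_join_def complete_graph_def permutability_graph_on_def f_less)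
    next
      case 4
      then show ?thesis unfolding P
        by (simp add: gS graph_join_def permutability_graph_on_def)
    qed
  qed
  have wfG: "parcs ?G \<subseteq> (N \<union> S) \<times> (N \<union> S)"
    by (auto simp: permutability_graph_on_def)
  \<comment> \<open>Every arc of the join has both ends in the image of \<open>g\<close>, so
    \<open>arc_iff\<close> also yields surjectivity on arcs.\<close>
  have wfJ: "parcs ?J \<subseteq> g ` (N \<union> S) \<times> g ` (N \<union> S)"
    unfolding img_verts
    by (auto simp: graph_join_def complete_graph_def permutability_graph_on_def)
  have img_arcs: "map_prod g g ` parcs ?G = parcs ?J"
  proof
    show "map_prod g g ` parcs ?G \<subseteq> parcs ?J"
      using arc_iff wfG by fastforce
    show "parcs ?J \<subseteq> map_prod g g ` parcs ?G"
    proof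
      fix e assume e: "e \<in> parcs ?J"
      then obtain H K where HK: "H \<in> N \<union> S" "K \<in> N \<union> S" "e = (g H, g K)"
        using wfJ by (cases e) blast
      then have "(H, K) \<in> parcs ?G" using arc_iff e by blast
      then show "e \<in> map_prod g g ` parcs ?G" using HK(3) by (force intro: rev_image_eqI)
    qed
  qed
  have inj_arcs: "inj_on (map_prod g g) (parcs ?G)"
    using map_prod_inj_on[OF g_inj g_inj] wfG by (rule inj_on_subset)
  interpret P: pair_bidirected_digraph ?G
    by (rule pair_bidirected_permutability_graph_on)
  let ?h = "\<lparr>iso_verts = g, iso_arcs = map_prod g g, iso_head = snd, iso_tail = fst\<rparr>"
  have vG: "pverts ?G = N \<union> S"
    by (simp add: permutability_graph_on_def)
  have "pre_digraph.digraph_isomorphism (with_proj ?G) ?h"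
    unfolding pre_digraph.digraph_isomorphism_def
    using P.wf_digraph_axioms g_inj inj_arcs vG by auto
  moreover have "with_proj ?J = app_iso ?h (with_proj ?G)"
    using img_verts img_arcs vG by (simp add: app_iso_def with_proj_def)
  ultimately show ?thesis
    unfolding digraph_iso_def permutability_graph_def nonnormal_permutability_graph_def V N_def S_def
    by blast
qed

section \<open>Groups with a dihedral multiplication table\<close>

text \<open>Separates the subgroup theory from the presentation. Here \<open>rot i\<close> stands
  for the power a^i and \<open>ref i\<close> for a^i b; all integers serve as indices, so reduction
  modulo \<open>n\<close> appears only in \<open>rot_eq_iff\<close> and
  \<open>ref_eq_iff\<close>.\<close>

locale dihedral = group G for G (structure) +
  fixes n :: nat and rot ref :: "int \<Rightarrow> 'a"
  assumes n_pos: "n > 0"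
    and carrier_eq: "carrier G = range rot \<union> range ref"
    and rot_rot: "rot i \<otimes> rot j = rot (i + j)"
    and rot_ref: "rot i \<otimes> ref j = ref (i + j)"
    and ref_rot: "ref i \<otimes> rot j = ref (i - j)"
    and ref_ref: "ref i \<otimes> ref j = rot (i - j)"
    and rot_eq_iff: "rot i = rot j \<longleftrightarrow> int n dvd i - j"
    and ref_eq_iff: "ref i = ref j \<longleftrightarrow> int n dvd i - j"
    and rot_neq_ref: "rot i \<noteq> ref j"
begin

lemmas mult_simps = rot_rot rot_ref ref_rot ref_ref

lemma closed [simp]: "rot i \<in> carrier G" "ref i \<in> carrier G"
  by (auto simp: carrier_eq)

lemma rot_0: "rot 0 = \<one>"
  using l_cancel_one[of "rot 0" "rot 0"] rot_rot[of 0 0] by simp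

lemma inv_rot: "inv (rot i) = rot (- i)"
  by (rule inv_equality) (simp_all add: rot_rot rot_0)

lemma inv_ref: "inv (ref i) = ref i"
  by (rule inv_equality) (simp_all add: ref_ref rot_0)

lemma rot_n: "rot (int n) = \<one>"
  unfolding rot_0[symmetric] rot_eq_iff by simp

lemma carrierE:
  assumes "x \<in> carrier G"
  obtains i where "x = rot i" | i where "x = ref i"
  using assms by (auto simp: carrier_eq)

text \<open>This is the cyclic subgroup generated by a^d.\<close>

definition rotations :: "nat \<Rightarrow> 'a set" where
  "rotations d = {rot i | i. int d dvd i}"

text \<open>This is the subgroup generated by a^2 and a^c b. For even \<open>n\<close> it has index
  2, and only the parity of \<open>c\<close> matters.\<close>

definition even_dihedral :: "int \<Rightarrow> 'a set" where
  "even_dihedral c = {rot i | i. even i} \<union> {ref i | i. even (i - c)}"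

section \<open>Subgroups consisting of rotations\<close>

text \<open>An element determines its index only modulo \<open>n\<close>; since \<open>d\<close>
  divides \<open>n\<close>, divisibility by \<open>d\<close> does not depend on the index
  chosen.\<close>

lemma rot_in_rotations_iff: "d dvd n \<Longrightarrow> rot i \<in> rotations d \<longleftrightarrow> int d dvd i"
proof
  assume "d dvd n" "rot i \<in> rotations d"
  then obtain j where "int d dvd j" "int n dvd i - j"
    by (auto simp: rotations_def rot_eq_iff)
  then show "int d dvd i"
    using \<open>d dvd n\<close> by (metis dvd_diff_right_iff dvd_trans dvd_diff_commute int_dvd_int_iff)
qed (auto simp: rotations_def)

text \<open>Conjugation by a rotation fixes every rotation, and conjugation by a reflection inverts
  it.\<close>

lemma rotations_normal: "rotations d \<lhd> G"
proof (rule normal_invI)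
  show "subgroup (rotations d) G"
  proof (rule subgroupI)
    show "rotations d \<noteq> {}" by (auto simp: rotations_def intro: exI[of _ 0])
  qed (auto simp: rotations_def inv_rot rot_rot)
next
  fix x h assume "x \<in> carrier G" "h \<in> rotations d"
  then obtain i where "h = rot i" "int d dvd i" by (auto simp: rotations_def)
  with \<open>x \<in> carrier G\<close> show "x \<otimes> h \<otimes> inv x \<in> rotations d"
    by (auto elim!: carrierE simp: inv_rot inv_ref mult_simps rotations_def)
qed

lemma inj_on_rotations: "inj_on rotations {d. d dvd n}"
proof (rule inj_onI)
  fix d e assume "d \<in> {d. d dvd n}" "e \<in> {d. d dvd n}" and eq: "rotations d = rotations e"
  then have "d dvd n" "e dvd n" by auto
  then have "int d dvd i \<longleftrightarrow> int e dvd i" for i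
    using rot_in_rotations_iff eq by metis
  then show "d = e" by (metis dvd_antisym dvd_refl int_dvd_int_iff)
qed

lemma rotations_n: "rotations n = {\<one>}"
  by (auto simp: rotations_def rot_0[symmetric] rot_eq_iff)

lemma rotations_proper: "rotations d \<noteq> carrier G"
proof -
  have "ref 0 \<notin> rotations d" using rot_neq_ref by (auto simp: rotations_def eq_commute)
  then show ?thesis using closed(2) by blast
qed

text \<open>The exponents \<open>i\<close> with \<open>rot i\<close> in \<open>H\<close> form a
  subgroup of the integers that contains \<open>n\<close>, hence consist of the multiples of a
  divisor of \<open>n\<close>.\<close>

lemma subgroup_rotations:
  assumes H: "subgroup H G" and "H \<subseteq> range rot"
  obtains d where "d dvd n" "H = rotations d"
proof -
  interpret H: subgroup H G by fact
  have add: "rot (i + j) \<in> H" if "rot i \<in> H" "rot j \<in> H" for i j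
    using H.m_closed[OF that] by (simp add: rot_rot)
  have minus: "rot (- i) \<in> H" if "rot i \<in> H" for i
    using H.m_inv_closed[OF that] by (simp add: inv_rot)
  have mult_nat: "rot (i * int k) \<in> H" if "rot i \<in> H" for i k
    by (induction k) (use that H.one_closed in \<open>auto simp: rot_0 ring_distribs intro: add\<close>)
  have mult: "rot (i * k) \<in> H" if "rot i \<in> H" for i k
    using mult_nat[OF that] minus by (cases k rule: int_cases2) force+
  \<comment> \<open>The generator \<open>d\<close> is the least positive exponent; one exists
    because \<open>rot (int n)\<close> is the identity.\<close>
  define P where "P d \<longleftrightarrow> d > 0 \<and> rot (int d) \<in> H" for d :: nat
  define d where "d = (LEAST d. P d)"
  have "P n" using n_pos H.one_closed by (simp add: P_def rot_n)
  then have "P d" unfolding d_def by (rule LeastI)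
  then have d: "d > 0" "rot (int d) \<in> H" by (auto simp: P_def)
  have min: "\<not> P m" if "m < d" for m
    using that unfolding d_def by (rule not_less_Least)
  have dvd: "int d dvd i" if "rot i \<in> H" for i
  proof -
    \<comment> \<open>The exponent is the remainder of \<open>i\<close> modulo \<open>d\<close>,
      which must vanish because \<open>d\<close> is minimal.\<close>
    have "rot (i + - (int d * (i div int d))) \<in> H"
      by (intro add minus mult that d)
    then have "rot (int (nat (i mod int d))) \<in> H"
      using d(1) by (simp add: minus_mult_div_eq_mod)
    moreover have "nat (i mod int d) < d" using d(1) by (simp add: nat_less_iff)
    ultimately have "nat (i mod int d) = 0" using min[of "nat (i mod int d)"] by (simp add: P_def)
    then have "i mod int d = 0"
      using d(1) pos_mod_sign[of "int d" i] by linarith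
    then show ?thesis by (rule mod_0_imp_dvd)
  qed
  have "d dvd n" using dvd[of "int n"] H.one_closed by (simp add: rot_n)
  moreover have "H = rotations d"
  proof
    show "H \<subseteq> rotations d" using assms(2) dvd by (auto simp: rotations_def)
    show "rotations d \<subseteq> H" using mult[OF d(2)] by (auto simp: rotations_def elim!: dvdE)
  qed
  ultimately show ?thesis by (rule that)
qed

section \<open>Normal subgroups containing a reflection\<close>

text \<open>For even \<open>n\<close> the parity of an index is an invariant of the element.\<close>

lemma ref_in_even_dihedral_iff: "even n \<Longrightarrow> ref i \<in> even_dihedral c \<longleftrightarrow> even (i - c)"
proof
  assume "even n" "ref i \<in> even_dihedral c"
  then obtain j where j: "even (j - c)" "int n dvd i - j"
    by (auto simp: even_dihedral_def ref_eq_iff rot_neq_ref[symmetric])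
  have "even (i - j)" using j(2) \<open>even n\<close> by (meson dvd_trans even_of_nat)
  with j(1) show "even (i - c)" by simp
qed (auto simp: even_dihedral_def)

lemma rot_in_even_dihedral_iff: "even n \<Longrightarrow> rot i \<in> even_dihedral c \<longleftrightarrow> even i"
proof
  assume "even n" "rot i \<in> even_dihedral c"
  then obtain j where j: "even j" "int n dvd i - j"
    by (auto simp: even_dihedral_def rot_eq_iff rot_neq_ref)
  have "even (i - j)" using j(2) \<open>even n\<close> by (meson dvd_trans even_of_nat)
  with j(1) show "even i" by simp
qed (auto simp: even_dihedral_def)

text \<open>Conjugation by \<open>rot k\<close> or \<open>ref k\<close> sends \<open>ref i\<close>
  to \<open>ref (i + 2 * k)\<close> or \<open>ref (2 * k - i)\<close> and \<open>rot i\<close> to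
  \<open>rot i\<close> or \<open>rot (- i)\<close>, so all parities are preserved.\<close>

lemma even_dihedral_normal: "even_dihedral c \<lhd> G"
proof (rule normal_invI)
  show "subgroup (even_dihedral c) G"
  proof (rule subgroupI)
    show "even_dihedral c \<noteq> {}" by (auto simp: even_dihedral_def intro: exI[of _ 0])
  qed (auto simp: even_dihedral_def inv_rot inv_ref mult_simps)
next
  fix x h assume "x \<in> carrier G" "h \<in> even_dihedral c"
  then show "x \<otimes> h \<otimes> inv x \<in> even_dihedral c"
    by (auto elim!: carrierE simp: inv_rot inv_ref mult_simps even_dihedral_def)
qed

lemma normal_subgroup_reflection:
  assumes "H \<lhd> G" "H \<noteq> carrier G" "ref j \<in> H"
  shows "even n" and "H = even_dihedral j"
proof -
  interpret H: normal H G by fact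
  \<comment> \<open>Conjugating \<open>ref j\<close> by \<open>rot 1\<close> gives
    \<open>ref (j + 2)\<close>, and multiplying this by \<open>ref j\<close> leaves
    \<open>rot 2\<close>.\<close>
  have "rot 1 \<otimes> ref j \<otimes> inv (rot 1) \<otimes> ref j \<in> H"
    using assms(3) by (intro H.m_closed H.inv_op_closed2) auto
  then have two: "rot 2 \<in> H" by (simp add: inv_rot mult_simps)
  have even_nat: "rot (int (2 * k)) \<in> H" for k
  proof (induction k)
    case (Suc k)
    then show ?case using H.m_closed[OF two Suc] by (simp add: rot_rot)
  qed (use H.one_closed in \<open>simp add: rot_0\<close>)
  have even: "rot i \<in> H" if "even i" for i
  proof (cases i rule: int_cases2)
    case (nonneg k)
    with that even_nat show ?thesis by (auto elim!: evenE)
  next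
    case (nonpos k)
    with that obtain l where "i = - int (2 * l)" by (auto elim!: evenE)
    then show ?thesis using H.m_inv_closed[OF even_nat[of l]] by (simp add: inv_rot)
  qed
  \<comment> \<open>An odd rotation together with the even ones gives all rotations; their products
    with \<open>ref j\<close> then give all reflections, so \<open>H\<close> would be the whole
    group.\<close>
  have not_odd: "rot i \<notin> H" if "odd i" for i
  proof
    assume "rot i \<in> H"
    have rots: "rot k \<in> H" for k
    proof (cases "even k")
      case False
      then have "rot (k - i) \<otimes> rot i \<in> H"
        using \<open>odd i\<close> \<open>rot i \<in> H\<close> even by (intro H.m_closed) auto
      then show ?thesis by (simp add: rot_rot)
    qed (rule even)
    moreover have "ref k \<in> H" for k
      using H.m_closed[OF rots[of "k - j"] assms(3)] by (simp add: rot_ref)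
    ultimately have "carrier G \<subseteq> H" by (auto simp: carrier_eq)
    with assms(2) H.subset show False by blast
  qed
  \<comment> \<open>The identity is \<open>rot (int n)\<close> and lies in \<open>H\<close>, so its
    index cannot be odd.\<close>
  show "even n"
    using not_odd[of "int n"] H.one_closed by (auto simp: rot_n)
  have rot_iff: "rot i \<in> H \<longleftrightarrow> even i" for i using even not_odd by blast
  \<comment> \<open>Right multiplication by \<open>ref j\<close> exchanges \<open>ref i\<close> and
    \<open>rot (i - j)\<close>.\<close>
  have "ref i \<in> H \<longleftrightarrow> rot (i - j) \<in> H" for i
    using H.m_closed[of "ref i" "ref j"] H.m_closed[of "rot (i - j)" "ref j"] assms(3)
    by (auto simp: mult_simps)
  then have ref_iff: "ref i \<in> H \<longleftrightarrow> even (i - j)" for i by (simp add: rot_iff)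
  have "H = (H \<inter> range rot) \<union> (H \<inter> range ref)"
    using H.subset by (auto simp: carrier_eq)
  also have "\<dots> = even_dihedral j"
    using rot_iff ref_iff by (auto simp: even_dihedral_def)
  finally show "H = even_dihedral j" .
qed

lemma even_dihedral_mod: "even_dihedral (c mod 2) = even_dihedral c"
  by (simp add: even_dihedral_def)

section \<open>Listing and counting the non-trivial proper normal subgroups\<close>

text \<open>The divisor \<open>n\<close> is left out because \<open>rotations n\<close> is trivial.
  A normal subgroup with a reflection \<open>ref j\<close> is determined by the parity of
  \<open>j\<close>, which leaves the representatives 0 and 1.\<close>

lemma proper_normal_subgroups_eq:
  "proper_normal_subgroups G = rotations ` ({d. d dvd n} - {n}) \<union>
     (if even n then {even_dihedral 0, even_dihedral 1} else {})" (is "_ = ?R")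
proof
  show "proper_normal_subgroups G \<subseteq> ?R"
  proof
    fix H assume "H \<in> proper_normal_subgroups G"
    then have H: "H \<lhd> G" "H \<noteq> {\<one>}" "H \<noteq> carrier G"
      by (auto simp: proper_normal_subgroups_def)
    show "H \<in> ?R"
    proof (cases "\<exists>j. ref j \<in> H")
      case True
      then obtain j where "ref j \<in> H" ..
      from normal_subgroup_reflection[OF H(1,3) this]
      have "even n" "H = even_dihedral (j mod 2)" by (simp_all add: even_dihedral_mod)
      moreover have "j mod 2 = 0 \<or> j mod 2 = 1" by auto
      ultimately show ?thesis by auto
    next
      case False
      then have "H \<subseteq> range rot"
        using subgroup.subset[OF normal_imp_subgroup[OF H(1)]] by (auto simp: carrier_eq)
      then obtain d where "d dvd n" "H = rotations d"
        using subgroup_rotations normal_imp_subgroup[OF H(1)] by blast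
      with H(2) rotations_n show ?thesis by auto
    qed
  qed
  show "?R \<subseteq> proper_normal_subgroups G"
  proof -
    have "rotations d \<noteq> {\<one>}" if "d dvd n" "d \<noteq> n" for d
      using that inj_on_rotations rotations_n by (auto simp: inj_on_def)
    moreover have "even_dihedral c \<noteq> {\<one>}" if "even n" for c
    proof -
      have "ref c \<in> even_dihedral c" by (simp add: ref_in_even_dihedral_iff that)
      then show ?thesis using rot_neq_ref[of 0 c] by (metis rot_0 singletonD)
    qed
    moreover have "even_dihedral c \<noteq> carrier G" if "even n" for c
    proof -
      have "rot 1 \<notin> even_dihedral c" by (simp add: rot_in_even_dihedral_iff that)
      then show ?thesis using closed(1) by blast
    qed
    ultimately show ?thesis
      using rotations_normal even_dihedral_normal rotations_proper
      by (auto simp: proper_normal_subgroups_def)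
  qed
qed

lemma finite_proper_normal_subgroups: "finite (proper_normal_subgroups G)"
  using n_pos by (simp add: proper_normal_subgroups_eq)

text \<open>The divisors other than \<open>n\<close> contribute \<open>num_divisors n - 1\<close>
  subgroups. For even \<open>n\<close> the two subgroups with reflections are new, and they are told
  apart by \<open>ref 0\<close>.\<close>

lemma card_proper_normal_subgroups:
  "card (proper_normal_subgroups G) =
     (if even n then num_divisors n + 1 else num_divisors n - 1)"
proof -
  have fin: "finite {d. d dvd n}" using n_pos by simp
  have "card (rotations ` ({d. d dvd n} - {n})) = card ({d. d dvd n} - {n})"
    by (rule card_image, rule inj_on_subset[OF inj_on_rotations]) blast
  also have "\<dots> = num_divisors n - 1"
    using fin by (simp add: num_divisors_def)
  finally have rots: "card (rotations ` ({d. d dvd n} - {n})) = num_divisors n - 1" .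
  have pos: "num_divisors n > 0"
    using fin by (auto simp: num_divisors_def card_gt_0_iff)
  have "even_dihedral c \<notin> range rotations" if "even n" for c
  proof -
    have "ref c \<in> even_dihedral c" by (simp add: ref_in_even_dihedral_iff that)
    moreover have "ref c \<notin> rotations d" for d
      using rot_neq_ref by (auto simp: rotations_def eq_commute)
    ultimately show ?thesis by blast
  qed
  moreover have "even_dihedral 0 \<noteq> even_dihedral 1" if "even n"
  proof -
    have "ref 0 \<in> even_dihedral 0" "ref 0 \<notin> even_dihedral 1"
      by (simp_all add: ref_in_even_dihedral_iff that)
    then show ?thesis by metis
  qed
  ultimately have "card (rotations ` ({d. d dvd n} - {n}) \<union> {even_dihedral 0, even_dihedral 1})
      = num_divisors n - 1 + 2" if "even n"
    using that fin rots by (subst card_Un_disjoint) auto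
  then show ?thesis
    using rots pos by (simp add: proper_normal_subgroups_eq)
qed

end

section \<open>The explicit model and the consequences of the presentation\<close>

text \<open>The pair \<open>(i, s)\<close> stands for $a^i$ if \<open>s\<close> is false and for $a^i b$ otherwise.\<close>

definition dihedral_model :: "nat \<Rightarrow> (int \<times> bool) monoid" where
  "dihedral_model n =
    \<lparr>carrier = {0..<int n} \<times> UNIV,
     monoid.mult = (\<lambda>(i, s) (j, t). ((if s then i - j else i + j) mod int n, s \<noteq> t)),
     monoid.one = (0, False)\<rparr>"

lemma group_dihedral_model:
  assumes "n > 0"
  shows "group (dihedral_model n)"
proof (rule groupI)
  fix x assume x: "x \<in> carrier (dihedral_model n)"
  obtain i s where [simp]: "x = (i, s)" by force
  show "\<exists>y\<in>carrier (dihedral_model n). y \<otimes>\<^bsub>dihedral_model n\<^esub> x = \<one>\<^bsub>dihedral_model n\<^esub>"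
    \<comment> \<open>A reflection is its own inverse; the exponent of a rotation is negated and
      reduced to stay in the carrier.\<close>
    by (rule bexI[of _ "(if s then i else - i mod int n, s)"])
      (use x assms in \<open>auto simp: dihedral_model_def mod_simps\<close>)
qed (use assms in \<open>auto simp: dihedral_model_def mod_simps algebra_simps\<close>)

text \<open>Collects what later arguments use of the presentation, so that words no longer occur:
  the relations, generation by two elements, and a homomorphism that bounds the group from below.
  The first coordinate is \<open>1 mod int n\<close> because the residue is 0 when \<open>n\<close>
  is 1.\<close>

lemma dihedral_group_relations:
  fixes n
  defines "G \<equiv> dihedral_group n"
  obtains a b where "a \<in> carrier G" "b \<in> carrier G"
    "a [^]\<^bsub>G\<^esub> n = \<one>\<^bsub>G\<^esub>" "b \<otimes>\<^bsub>G\<^esub> b = \<one>\<^bsub>G\<^esub>" "a \<otimes>\<^bsub>G\<^esub> b = b \<otimes>\<^bsub>G\<^esub> inv\<^bsub>G\<^esub> a"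
    "carrier G = generate G {a, b}"
    "n > 0 \<Longrightarrow> \<exists>h\<in>hom G (dihedral_model n). h a = (1 mod int n, False) \<and> h b = (0, True)"
proof -
  define R where "R =
    {(replicate n (Gen_a, True), []),
     ([(Gen_b, True), (Gen_b, True)], []),
     ([(Gen_a, True), (Gen_b, True)], [(Gen_b, True), (Gen_a, False)])}"
  have G: "G = presented_group R" by (simp add: G_def dihedral_group_def R_def)
  interpret group G unfolding G by (rule group_presented_group)
  define gen where "gen x = word_class R [(x, True)]" for x
  have carr [simp]: "word_class R u \<in> carrier G" for u
    by (simp add: G presented_group_carrier)
  have one: "\<one>\<^bsub>G\<^esub> = word_class R []" by (simp add: G presented_group_one)
  have mult: "word_class R u \<otimes>\<^bsub>G\<^esub> word_class R v = word_class R (u @ v)" for u v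
    by (simp add: G presented_group_mult)
  have rel: "word_class R u = word_class R v" if "(u, v) \<in> R" for u v
    using that by (simp add: word_class_eq_iff word_eq_rel)
  have inv_gen: "inv\<^bsub>G\<^esub> (gen x) = word_class R [(x, False)]" for x
    using word_eq_cancel[of R x False]
    by (intro inv_equality) (simp_all add: gen_def mult one word_class_eq_iff)
  have pow: "gen x [^]\<^bsub>G\<^esub> k = word_class R (replicate k (x, True))" for x and k :: nat
  proof (induction k)
    case (Suc k)
    then show ?case
      by (simp add: mult gen_def replicate_append_same)
  qed (simp add: one)
  let ?S = "{gen Gen_a, gen Gen_b}"
  have gen_in: "gen x \<in> ?S" for x by (cases x) auto
  have word_gen: "word_class R u \<in> generate G ?S" for u
  proof (induction u)
    case Nil
    show ?case unfolding one[symmetric] by (rule generate.one)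
  next
    case (Cons p u)
    obtain x e where p: "p = (x, e)" by force
    have "word_class R [p] \<in> generate G ?S"
    proof (cases e)
      case True
      with p gen_in[of x] show ?thesis by (simp only: gen_def[symmetric] generate.incl)
    next
      case False
      then have "word_class R [p] = inv\<^bsub>G\<^esub> (gen x)" by (simp add: inv_gen p)
      then show ?thesis using generate.inv[OF gen_in] by simp
    qed
    from generate.eng[OF this Cons.IH] show ?case by (simp add: mult)
  qed
  show thesis
  proof
    show "gen Gen_a \<in> carrier G" "gen Gen_b \<in> carrier G" by (simp_all add: gen_def)
    show "gen Gen_a [^]\<^bsub>G\<^esub> n = \<one>\<^bsub>G\<^esub>" unfolding pow one by (rule rel) (simp add: R_def)
    show "gen Gen_b \<otimes>\<^bsub>G\<^esub> gen Gen_b = \<one>\<^bsub>G\<^esub>"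
      unfolding gen_def mult one by (rule rel) (simp add: R_def)
    show "gen Gen_a \<otimes>\<^bsub>G\<^esub> gen Gen_b = gen Gen_b \<otimes>\<^bsub>G\<^esub> inv\<^bsub>G\<^esub> gen Gen_a"
      unfolding inv_gen unfolding gen_def mult by (rule rel) (simp add: R_def)
    have "carrier G \<subseteq> generate G ?S"
      using word_gen by (auto simp: G presented_group_carrier)
    moreover have "generate G ?S \<subseteq> carrier G"
      by (rule generate_incl) (auto simp: gen_def)
    ultimately show "carrier G = generate G ?S" by blast
    assume "n > 0"
    interpret M: group "dihedral_model n" using \<open>n > 0\<close> by (rule group_dihedral_model)
    define f where "f x = (case x of Gen_a \<Rightarrow> (1 mod int n, False) | Gen_b \<Rightarrow> (0, True))" for x
    have f_carr: "f x \<in> carrier (dihedral_model n)" for x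
      using \<open>n > 0\<close> by (cases x) (auto simp: f_def dihedral_model_def)
    have inv_a: "inv\<^bsub>dihedral_model n\<^esub> (f Gen_a) = (- 1 mod int n, False)"
      using \<open>n > 0\<close> f_carr[of Gen_a]
      by (intro M.inv_equality) (auto simp: f_def dihedral_model_def mod_simps)
    \<comment> \<open>At \<open>k = n\<close> this is the identity of the model, which verifies the
      relation a^n = 1 there.\<close>
    have rep: "word_value (dihedral_model n) f (replicate k (Gen_a, True)) = (int k mod int n, False)"
      for k
      by (induction k) (simp_all add: word_value_def dihedral_model_def f_def mod_simps)
    have "word_value (dihedral_model n) f u = word_value (dihedral_model n) f v"
      if "(u, v) \<in> R" for u v
      using that rep[of n] inv_a
      by (auto simp: R_def word_value_def dihedral_model_def f_def mod_simps)
    from presented_group_universal[OF M.is_group f_carr this]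
    obtain h where "h \<in> hom G (dihedral_model n)" "\<And>x. h (gen x) = f x"
      unfolding G gen_def by blast
    then show "\<exists>h\<in>hom G (dihedral_model n). h (gen Gen_a) = (1 mod int n, False) \<and> h (gen Gen_b) = (0, True)"
      by (intro bexI[of _ h]) (simp_all add: f_def)
  qed
qed

section \<open>The multiplication table of the presented group\<close>

text \<open>The relations bring every element into the form a^i or a^i b and give the multiplication
  rules; the homomorphism to the model shows that no further equalities hold.\<close>

lemma dihedral_dihedral_group:
  assumes "n > 0"
  shows "\<exists>rot ref. dihedral (dihedral_group n) n rot ref"
proof -
  define G where "G = dihedral_group n"
  interpret group G unfolding G_def dihedral_group_def by (rule group_presented_group)
  obtain a b h where [simp]: "a \<in> carrier G" "b \<in> carrier G"
    and an: "a [^]\<^bsub>G\<^esub> n = \<one>\<^bsub>G\<^esub>" and bb: "b \<otimes>\<^bsub>G\<^esub> b = \<one>\<^bsub>G\<^esub>"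
    and ab: "a \<otimes>\<^bsub>G\<^esub> b = b \<otimes>\<^bsub>G\<^esub> inv\<^bsub>G\<^esub> a"
    and gen: "carrier G = generate G {a, b}"
    and h: "h \<in> hom G (dihedral_model n)" "h a = (1 mod int n, False)" "h b = (0, True)"
    using dihedral_group_relations[of n] assms unfolding G_def by metis
  interpret M: group "dihedral_model n" using assms by (rule group_dihedral_model)
  interpret h: group_hom G "dihedral_model n" h
    by unfold_locales (rule h)
  define rot where "rot i = a [^]\<^bsub>G\<^esub> i" for i :: int
  define ref where "ref i = rot i \<otimes>\<^bsub>G\<^esub> b" for i
  have [simp]: "rot i \<in> carrier G" "ref i \<in> carrier G" for i
    by (simp_all add: rot_def ref_def)
  have rot_rot: "rot i \<otimes>\<^bsub>G\<^esub> rot j = rot (i + j)" for i j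
    by (simp add: rot_def int_pow_mult)
  have rot_0: "rot 0 = \<one>\<^bsub>G\<^esub>" by (simp add: rot_def)
  have inv_b: "inv\<^bsub>G\<^esub> b = b" using bb by (intro inv_equality) simp_all
  have "b \<otimes>\<^bsub>G\<^esub> a \<otimes>\<^bsub>G\<^esub> b = inv\<^bsub>G\<^esub> a"
  proof -
    have "b \<otimes>\<^bsub>G\<^esub> (a \<otimes>\<^bsub>G\<^esub> b) = b \<otimes>\<^bsub>G\<^esub> b \<otimes>\<^bsub>G\<^esub> inv\<^bsub>G\<^esub> a" by (simp add: ab m_assoc)
    then show ?thesis by (simp add: bb m_assoc)
  qed
  then have conj_pow: "b \<otimes>\<^bsub>G\<^esub> a [^]\<^bsub>G\<^esub> k \<otimes>\<^bsub>G\<^esub> b = rot (- int k)" for k :: nat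
  proof (induction k)
    case 0
    show ?case by (simp add: bb rot_0)
  next
    case (Suc k)
    \<comment> \<open>Inserting b b = 1 before the last factor a splits the conjugate of the power
      into a product of conjugates.\<close>
    have "b \<otimes>\<^bsub>G\<^esub> a [^]\<^bsub>G\<^esub> Suc k \<otimes>\<^bsub>G\<^esub> b
        = (b \<otimes>\<^bsub>G\<^esub> a [^]\<^bsub>G\<^esub> k) \<otimes>\<^bsub>G\<^esub> (b \<otimes>\<^bsub>G\<^esub> b) \<otimes>\<^bsub>G\<^esub> (a \<otimes>\<^bsub>G\<^esub> b)"
      by (simp add: bb m_assoc)
    also have "\<dots> = (b \<otimes>\<^bsub>G\<^esub> a [^]\<^bsub>G\<^esub> k \<otimes>\<^bsub>G\<^esub> b) \<otimes>\<^bsub>G\<^esub> (b \<otimes>\<^bsub>G\<^esub> a \<otimes>\<^bsub>G\<^esub> b)"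
      by (simp add: m_assoc)
    also have "\<dots> = rot (- int k) \<otimes>\<^bsub>G\<^esub> rot (- 1)"
      using Suc by (simp add: rot_def int_pow_neg)
    finally show ?case by (simp add: rot_rot algebra_simps)
  qed
  have b_rot: "b \<otimes>\<^bsub>G\<^esub> rot i = rot (- i) \<otimes>\<^bsub>G\<^esub> b" for i
  proof -
    have "b \<otimes>\<^bsub>G\<^esub> rot i \<otimes>\<^bsub>G\<^esub> b = rot (- i)"
    proof (cases i rule: int_cases2)
      case (nonneg k)
      then show ?thesis using conj_pow[of k] by (simp add: rot_def int_pow_int)
    next
      case (nonpos k)
      \<comment> \<open>Conjugation by b is an involution, so negative exponents follow from
        \<open>conj_pow\<close> by conjugating once more.\<close>
      have "b \<otimes>\<^bsub>G\<^esub> rot i \<otimes>\<^bsub>G\<^esub> b = b \<otimes>\<^bsub>G\<^esub> (b \<otimes>\<^bsub>G\<^esub> a [^]\<^bsub>G\<^esub> k \<otimes>\<^bsub>G\<^esub> b) \<otimes>\<^bsub>G\<^esub> b"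
        using nonpos conj_pow[of k] by simp
      also have "\<dots> = (b \<otimes>\<^bsub>G\<^esub> b) \<otimes>\<^bsub>G\<^esub> a [^]\<^bsub>G\<^esub> k \<otimes>\<^bsub>G\<^esub> (b \<otimes>\<^bsub>G\<^esub> b)"
        by (simp only: m_assoc m_closed nat_pow_closed \<open>a \<in> carrier G\<close> \<open>b \<in> carrier G\<close>)
      finally show ?thesis using nonpos by (simp add: bb rot_def int_pow_int)
    qed
    then show ?thesis using inv_solve_right[of "b \<otimes>\<^bsub>G\<^esub> rot i" "rot (- i)" b] inv_b by simp
  qed
  have rot_ref: "rot i \<otimes>\<^bsub>G\<^esub> ref j = ref (i + j)" for i j
    by (simp add: ref_def m_assoc[symmetric] rot_rot)
  have ref_rot: "ref i \<otimes>\<^bsub>G\<^esub> rot j = ref (i - j)" for i j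
  proof -
    have "ref i \<otimes>\<^bsub>G\<^esub> rot j = rot i \<otimes>\<^bsub>G\<^esub> (b \<otimes>\<^bsub>G\<^esub> rot j)" by (simp add: ref_def m_assoc)
    then show ?thesis by (simp add: b_rot m_assoc[symmetric] rot_rot ref_def)
  qed
  have ref_ref: "ref i \<otimes>\<^bsub>G\<^esub> ref j = rot (i - j)" for i j
  proof -
    have "ref i \<otimes>\<^bsub>G\<^esub> ref j = ref i \<otimes>\<^bsub>G\<^esub> rot j \<otimes>\<^bsub>G\<^esub> b" by (simp add: ref_def[of j] m_assoc)
    also have "\<dots> = rot (i - j) \<otimes>\<^bsub>G\<^esub> (b \<otimes>\<^bsub>G\<^esub> b)"
      unfolding ref_rot by (simp add: ref_def m_assoc)
    finally show ?thesis by (simp add: bb)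
  qed
  have inv_rot: "inv\<^bsub>G\<^esub> rot i = rot (- i)" for i by (simp add: rot_def int_pow_neg)
  have inv_ref: "inv\<^bsub>G\<^esub> ref i = ref i" for i
    by (rule inv_equality) (simp_all add: ref_ref rot_0)
  have a_rot: "a = rot 1" by (simp add: rot_def)
  have b_ref: "b = ref 0" by (simp add: ref_def rot_0)
  \<comment> \<open>The normal forms are closed under products and inverses and include both
    generators, so they exhaust the group.\<close>
  have "subgroup (range rot \<union> range ref) G"
    by (rule subgroupI) (auto simp: inv_rot inv_ref rot_rot rot_ref ref_rot ref_ref)
  then have "generate G {a, b} \<subseteq> range rot \<union> range ref"
    by (rule generate_subgroup_incl[rotated]) (auto simp: a_rot b_ref)
  then have carrier: "carrier G = range rot \<union> range ref"
    using gen by auto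
  have h_pow: "h (a [^]\<^bsub>G\<^esub> k) = (int k mod int n, False)" for k :: nat
  proof (induction k)
    case 0
    show ?case using h.hom_one by (simp add: dihedral_model_def)
  next
    case (Suc k)
    then show ?case by (simp add: h(2)) (simp add: dihedral_model_def mod_simps algebra_simps)
  qed
  have rot_n: "rot (int n * k) = \<one>\<^bsub>G\<^esub>" for k
    using int_pow_pow[of a "int n" k] an by (simp add: rot_def int_pow_int)
  have rot_mod: "rot (i mod int n) = rot i" for i
    using rot_rot[of "int n * (i div int n)" "i mod int n"] by (simp add: rot_n)
  \<comment> \<open>The value of \<open>h\<close> is known at natural exponents, so an integer
    exponent is first replaced by its residue modulo \<open>n\<close>.\<close>
  have h_rot: "h (rot i) = (i mod int n, False)" for i
    using h_pow[of "nat (i mod int n)"] rot_mod[of i] assms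
    by (simp add: rot_def int_pow_int[symmetric])
  have h_ref: "h (ref i) = (i mod int n, True)" for i
    by (simp add: ref_def h_rot h(3)) (simp add: dihedral_model_def)
  have rot_eq: "rot i = rot j" if "int n dvd i - j" for i j
    using rot_mod that by (metis mod_eq_dvd_iff)
  have "dihedral G n rot ref"
  proof unfold_locales
    \<comment> \<open>Equality of residues follows by applying \<open>h\<close>; the converse is the
      relation a^n = 1 in the form \<open>rot_eq\<close>.\<close>
    show "rot i = rot j \<longleftrightarrow> int n dvd i - j" for i j
      using h_rot rot_eq by (metis mod_eq_dvd_iff prod.inject)
    show "ref i = ref j \<longleftrightarrow> int n dvd i - j" for i j
      using h_ref rot_eq unfolding ref_def by (metis mod_eq_dvd_iff prod.inject)
    show "rot i \<noteq> ref j" for i j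
      using h_rot h_ref by (metis prod.inject)
  qed (fact assms carrier rot_rot rot_ref ref_rot ref_ref)+
  then show ?thesis unfolding G_def by blast
qed

theorem theorem4p8:
  fixes n r :: nat
  assumes "n \<ge> 3"
    and "r = (if even n then num_divisors n + 1 else num_divisors n - 1)"
  shows "digraph_iso
    (with_proj (permutability_graph (dihedral_group n)))
    (with_proj (graph_join (complete_graph r) (nonnormal_permutability_graph (dihedral_group n))))"
proof -
  obtain rot ref where "dihedral (dihedral_group n) n rot ref"
    using dihedral_dihedral_group[of n] assms(1) by auto
  then interpret dihedral "dihedral_group n" n rot ref .
  show ?thesis
    using permutability_graph_iso_join[OF finite_proper_normal_subgroups]
    by (simp only: card_proper_normal_subgroups assms(2))
qed

end
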